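(* If $G$ and $H$ are compatibly almost opposable finite simple graphs, then the strong product $G\boxtimes H$ is compatibly almost opposable.
   Context: All graphs are finite and simple. $N[v]$ denotes the closed neighbourhood of $v$. "Automorphism of order two" means an automorphism $f$ with $f\circ f=\mathrm{id}$. An opposition of a graph $G$ is an automorphism $f$ of $G$ of order two such that $f(v)\notin N[v]$ for all $v\in V(G)$. A graph is opposable if it has an opposition (the empty graph is vacuously opposable). A set $S\subseteq V(G)$ is admissible if $u\in S\subseteq N[u]$ for some $u\in V(G)$. The graph $G$ is almost opposable if there is an admissible set $S$ such that $G-S$ is opposable. For an almost opposable graph $G$ and an admissible set $S$, an opposition $f$ of $G-S$ is compatible if there is an automorphism $\alpha$ of $G$ of order two such that $\alpha(x)=f(x)$ for all $x\in V(G-S)$. The graph $G$ is compatibly almost opposable if $G-S$ has a compatible opposition for some admissible set $S$. The strong product $G\boxtimes H$ has vertex set $V(G)\times V(H)$, with distinct vertices $(g_1,h_1),(g_2,h_2)$ adjacent iff ($g_1=g_2$ or $g_1g_2\in E(G)$) and ($h_1=h_2$ or $h_1h_2\in E(H)$). *)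

theory Defs
  imports "Graph_Theory.Digraph_Component"
begin

text \<open>
  A finite simple graph is a digraph satisfying the locale predicate \<^const>\<open>graph\<close>
  (finite, symmetric, without loops or parallel arcs); adjacency of \<open>u\<close> and \<open>v\<close> is
  \<open>u \<rightarrow>\<^bsub>G\<^esub> v\<close>. The vertex set may be empty.
\<close>

definition closed_nbhd :: "('a, 'b) pre_digraph \<Rightarrow> 'a \<Rightarrow> 'a set" where
  "closed_nbhd G v = insert v {w \<in> verts G. v \<rightarrow>\<^bsub>G\<^esub> w}"

text \<open>
  Maps on the vertex set are represented by total functions on the vertex type; their values
  outside the vertex set are irrelevant.
\<close>

definition automorphism :: "('a, 'b) pre_digraph \<Rightarrow> ('a \<Rightarrow> 'a) \<Rightarrow> bool" where
  "automorphism G f \<longleftrightarrow> bij_betw f (verts G) (verts G) \<and>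
     (\<forall>u \<in> verts G. \<forall>v \<in> verts G. u \<rightarrow>\<^bsub>G\<^esub> v \<longleftrightarrow> f u \<rightarrow>\<^bsub>G\<^esub> f v)"

text \<open>
  Order two means \<open>f \<circ> f = id\<close> on the vertices; the identity is included.
\<close>

definition automorphism_order_two :: "('a, 'b) pre_digraph \<Rightarrow> ('a \<Rightarrow> 'a) \<Rightarrow> bool" where
  "automorphism_order_two G f \<longleftrightarrow> automorphism G f \<and> (\<forall>v \<in> verts G. f (f v) = v)"

definition opposition :: "('a, 'b) pre_digraph \<Rightarrow> ('a \<Rightarrow> 'a) \<Rightarrow> bool" where
  "opposition G f \<longleftrightarrow>
     automorphism_order_two G f \<and> (\<forall>v \<in> verts G. f v \<notin> closed_nbhd G v)"

definition admissible :: "('a, 'b) pre_digraph \<Rightarrow> 'a set \<Rightarrow> bool" where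
  "admissible G S \<longleftrightarrow> S \<subseteq> verts G \<and> (\<exists>u \<in> verts G. u \<in> S \<and> S \<subseteq> closed_nbhd G u)"

definition delete_verts :: "('a, 'b) pre_digraph \<Rightarrow> 'a set \<Rightarrow> ('a, 'b) pre_digraph" where
  "delete_verts G S = G \<restriction> (verts G - S)"

definition compatible_opposition ::
  "('a, 'b) pre_digraph \<Rightarrow> 'a set \<Rightarrow> ('a \<Rightarrow> 'a) \<Rightarrow> bool" where
  "compatible_opposition G S f \<longleftrightarrow> opposition (delete_verts G S) f \<and>
     (\<exists>\<alpha>. automorphism_order_two G \<alpha> \<and> (\<forall>x \<in> verts (delete_verts G S). \<alpha> x = f x))"

definition compatibly_almost_opposable :: "('a, 'b) pre_digraph \<Rightarrow> bool" where
  "compatibly_almost_opposable G \<longleftrightarrow>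
     (\<exists>S. admissible G S \<and> (\<exists>f. compatible_opposition G S f))"

text \<open>
  The arcs of the product are ordered pairs of vertices, both orientations of every edge.
\<close>

definition strong_product ::
  "('a, 'b) pre_digraph \<Rightarrow> ('c, 'd) pre_digraph \<Rightarrow>
     ('a \<times> 'c, ('a \<times> 'c) \<times> ('a \<times> 'c)) pre_digraph" (infixl \<open>\<boxtimes>\<close> 70) where
  "G \<boxtimes> H = with_proj \<lparr>
     pverts = verts G \<times> verts H,
     parcs = {((g1, h1), (g2, h2)) | g1 h1 g2 h2.
       (g1, h1) \<in> verts G \<times> verts H \<and> (g2, h2) \<in> verts G \<times> verts H \<and>
       (g1, h1) \<noteq> (g2, h2) \<and>
       (g1 = g2 \<or> g1 \<rightarrow>\<^bsub>G\<^esub> g2) \<and> (h1 = h2 \<or> h1 \<rightarrow>\<^bsub>H\<^esub> h2)}\<rparr>"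

lemma graph_strong_product:
  assumes "graph G" "graph H"
  shows "graph (G \<boxtimes> H)"
proof -
  interpret G: graph G by fact
  interpret H: graph H by fact
  have "arcs (G \<boxtimes> H) \<subseteq> (verts G \<times> verts H) \<times> (verts G \<times> verts H)"
    by (auto simp: strong_product_def)
  then have "finite (arcs (G \<boxtimes> H))"
    by (rule finite_subset) auto
  moreover have "symmetric (G \<boxtimes> H)"
    using G.sym_arcs H.sym_arcs
    unfolding symmetric_def sym_def by (auto simp: strong_product_def)
  ultimately show ?thesis
    by unfold_locales (auto simp: strong_product_def arc_to_ends_def)
qed

end

theory Submission
  imports Defs
begin

text \<open>
  If \<open>\<alpha>\<close> and \<open>\<beta>\<close> extend oppositions of \<open>G - S\<close> and \<open>H - T\<close>, then \<open>\<alpha> \<times> \<beta>\<close> is an automorphism of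
  \<open>G \<boxtimes> H\<close> of order two that preserves \<open>S \<times> T\<close>. A vertex outside \<open>S \<times> T\<close> has a coordinate
  outside \<open>S\<close> or \<open>T\<close>; that coordinate is moved out of its closed neighbourhood, and hence so
  is the vertex.
\<close>

lemma verts_strong_product [simp]: "verts (G \<boxtimes> H) = verts G \<times> verts H"
  by (simp add: strong_product_def)

lemma strong_product_adj_iff:
  "(g, h) \<rightarrow>\<^bsub>G \<boxtimes> H\<^esub> (g', h') \<longleftrightarrow>
     g \<in> verts G \<and> h \<in> verts H \<and> g' \<in> verts G \<and> h' \<in> verts H \<and> (g, h) \<noteq> (g', h') \<and>
     (g = g' \<or> g \<rightarrow>\<^bsub>G\<^esub> g') \<and> (h = h' \<or> h \<rightarrow>\<^bsub>H\<^esub> h')"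
  by (auto simp: strong_product_def arcs_ends_def arc_to_ends_def)

lemma mem_closed_nbhd_iff: "w \<in> closed_nbhd G v \<longleftrightarrow> w = v \<or> w \<in> verts G \<and> v \<rightarrow>\<^bsub>G\<^esub> w"
  by (simp add: closed_nbhd_def)

text \<open>A closed neighbourhood contains its centre, which absorbs the distinctness clause in the
  adjacency of the product and leaves two independent conditions on the coordinates.\<close>

lemma closed_nbhd_strong_product:
  assumes "g \<in> verts G" "h \<in> verts H"
  shows "closed_nbhd (G \<boxtimes> H) (g, h) = closed_nbhd G g \<times> closed_nbhd H h"
  using assms by (auto simp: mem_closed_nbhd_iff strong_product_adj_iff)

lemma verts_delete_verts [simp]: "verts (delete_verts G S) = verts G - S"
  by (simp add: delete_verts_def)

lemma delete_verts_adj_iff: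
  "u \<rightarrow>\<^bsub>delete_verts G S\<^esub> v \<longleftrightarrow> u \<in> verts G - S \<and> v \<in> verts G - S \<and> u \<rightarrow>\<^bsub>G\<^esub> v"
  by (auto simp: delete_verts_def arcs_ends_def arc_to_ends_def)

lemma closed_nbhd_delete_verts:
  "v \<in> verts G - S \<Longrightarrow> closed_nbhd (delete_verts G S) v = closed_nbhd G v - S"
  by (auto simp: mem_closed_nbhd_iff delete_verts_adj_iff)

text \<open>An involution of the vertex set is its own inverse, so mapping \<open>verts G\<close>
  into itself already gives bijectivity.\<close>

lemma automorphism_order_two_iff:
  "automorphism_order_two G f \<longleftrightarrow>
     (\<forall>v \<in> verts G. f v \<in> verts G \<and> f (f v) = v) \<and>
     (\<forall>u \<in> verts G. \<forall>v \<in> verts G. f u \<rightarrow>\<^bsub>G\<^esub> f v \<longleftrightarrow> u \<rightarrow>\<^bsub>G\<^esub> v)"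
proof -
  have "bij_betw f (verts G) (verts G)" if "\<forall>v \<in> verts G. f v \<in> verts G \<and> f (f v) = v"
    using that by (intro bij_betw_byWitness[where f' = f]) auto
  then show ?thesis
    unfolding automorphism_order_two_def automorphism_def by (blast dest: bij_betwE)
qed

text \<open>A compatible opposition is determined on its vertices by the automorphism extending it,
  so \<open>f\<close> can be eliminated. The clause \<open>\<alpha> v \<notin> S\<close> records
  that \<open>\<alpha>\<close> restricts to \<open>G - S\<close>.\<close>

lemma compatibly_almost_opposable_iff:
  "compatibly_almost_opposable G \<longleftrightarrow>
     (\<exists>S \<alpha>. admissible G S \<and> automorphism_order_two G \<alpha> \<and>
        (\<forall>v \<in> verts G - S. \<alpha> v \<notin> S \<and> \<alpha> v \<notin> closed_nbhd G v))"
  (is "?L \<longleftrightarrow> (\<exists>S \<alpha>. ?R S \<alpha>)")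
proof
  assume ?L
  then obtain S f \<alpha> where S: "admissible G S" and f: "opposition (delete_verts G S) f"
    and \<alpha>: "automorphism_order_two G \<alpha>" and eq: "\<forall>x \<in> verts G - S. \<alpha> x = f x"
    by (auto simp: compatibly_almost_opposable_def compatible_opposition_def)
  have "\<alpha> v \<notin> S \<and> \<alpha> v \<notin> closed_nbhd G v" if "v \<in> verts G - S" for v
    \<comment> \<open>Here \<open>f v\<close> lies in \<open>verts G - S\<close>, where the closed
      neighbourhoods of \<open>v\<close> in \<open>G\<close> and in \<open>G - S\<close>
      agree.\<close>
    using f that eq
    by (auto simp: opposition_def automorphism_order_two_iff closed_nbhd_delete_verts)
  with S \<alpha> show "\<exists>S \<alpha>. ?R S \<alpha>" by blast
next
  assume "\<exists>S \<alpha>. ?R S \<alpha>"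
  then obtain S \<alpha> where R: "?R S \<alpha>" by blast
  \<comment> \<open>The extension itself serves as \<open>f\<close>: it preserves
    \<open>verts G - S\<close>, and the induced subgraph inherits its adjacency from
    \<open>G\<close>.\<close>
  then have "opposition (delete_verts G S) \<alpha>"
    by (auto simp: opposition_def automorphism_order_two_iff closed_nbhd_delete_verts
        delete_verts_adj_iff)
  with R show ?L
    unfolding compatibly_almost_opposable_def compatible_opposition_def by blast
qed

text \<open>The pair of the two centres is a centre for \<open>S \<times> T\<close>, since its
  closed neighbourhood is the product of theirs.\<close>

lemma admissible_strong_product:
  assumes "admissible G S" "admissible H T"
  shows "admissible (G \<boxtimes> H) (S \<times> T)"
proof -
  obtain u w where "u \<in> verts G" "u \<in> S" "S \<subseteq> closed_nbhd G u"
    and "w \<in> verts H" "w \<in> T" "T \<subseteq> closed_nbhd H w"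
    using assms by (auto simp: admissible_def)
  then have "(u, w) \<in> verts (G \<boxtimes> H)" "(u, w) \<in> S \<times> T"
    "S \<times> T \<subseteq> closed_nbhd (G \<boxtimes> H) (u, w)"
    by (auto simp: closed_nbhd_strong_product)
  moreover have "S \<times> T \<subseteq> verts (G \<boxtimes> H)"
    using assms by (auto simp: admissible_def)
  ultimately show ?thesis
    unfolding admissible_def by blast
qed

lemma automorphism_order_two_strong_product:
  assumes "automorphism_order_two G \<alpha>" "automorphism_order_two H \<beta>"
  shows "automorphism_order_two (G \<boxtimes> H) (map_prod \<alpha> \<beta>)"
proof -
  \<comment> \<open>Adjacency in the product also compares coordinates for equality, so injectivity
    is needed besides preservation of arcs.\<close>
  have inj: "\<alpha> g = \<alpha> g' \<longleftrightarrow> g = g'" if "g \<in> verts G" "g' \<in> verts G" for g g'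
    using assms(1) that unfolding automorphism_order_two_iff by metis
  have inj': "\<beta> h = \<beta> h' \<longleftrightarrow> h = h'" if "h \<in> verts H" "h' \<in> verts H" for h h'
    using assms(2) that unfolding automorphism_order_two_iff by metis
  show ?thesis
    using assms by (simp add: automorphism_order_two_iff strong_product_adj_iff inj inj')
qed

theorem theorem4p4:
  fixes G :: "('a, 'b) pre_digraph" and H :: "('c, 'd) pre_digraph"
  assumes "graph G" and "graph H"
    and "compatibly_almost_opposable G" and "compatibly_almost_opposable H"
  shows "compatibly_almost_opposable (G \<boxtimes> H)"
proof -
  obtain S \<alpha> where S: "admissible G S" and \<alpha>: "automorphism_order_two G \<alpha>"
    and mv: "\<And>v. v \<in> verts G - S \<Longrightarrow> \<alpha> v \<notin> S \<and> \<alpha> v \<notin> closed_nbhd G v"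
    using assms(3) unfolding compatibly_almost_opposable_iff by blast
  obtain T \<beta> where T: "admissible H T" and \<beta>: "automorphism_order_two H \<beta>"
    and mv': "\<And>v. v \<in> verts H - T \<Longrightarrow> \<beta> v \<notin> T \<and> \<beta> v \<notin> closed_nbhd H v"
    using assms(4) unfolding compatibly_almost_opposable_iff by blast
  have "\<forall>v \<in> verts (G \<boxtimes> H) - S \<times> T.
      map_prod \<alpha> \<beta> v \<notin> S \<times> T \<and> map_prod \<alpha> \<beta> v \<notin> closed_nbhd (G \<boxtimes> H) v"
  proof
    fix v assume "v \<in> verts (G \<boxtimes> H) - S \<times> T"
    then obtain g h where v: "v = (g, h)" "g \<in> verts G" "h \<in> verts H" "g \<notin> S \<or> h \<notin> T"
      by auto
    \<comment> \<open>Both sets to be avoided are products, so one coordinate that escapes its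
      factor in each of them suffices.\<close>
    with mv[of g] mv'[of h]
    show "map_prod \<alpha> \<beta> v \<notin> S \<times> T \<and> map_prod \<alpha> \<beta> v \<notin> closed_nbhd (G \<boxtimes> H) v"
      by (auto simp: closed_nbhd_strong_product)
  qed
  with admissible_strong_product[OF S T] automorphism_order_two_strong_product[OF \<alpha> \<beta>]
  show ?thesis
    unfolding compatibly_almost_opposable_iff by (intro exI conjI)
qed

end
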